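(* Let $U\subset\mathbb R^N$ be open, $N\ge2$, $p>1$, and $w\in C^2(U)$. At every point $x\in U$ with $\nabla w(x)\neq0$, \[ M_p[w](x)\ge0\quad\Longrightarrow\quad D^2w(x)\ge0. \] The converse implication (namely $D^2w(x)\ge0\Rightarrow M_p[w](x)\ge0$) holds for all such $U,w,x$ if and only if $p=2$.
   Context: At points where $\nabla w\neq0$, \[ M_p[w]:=\frac12\bigl(DA+(DA)^T\bigr),\qquad A:=|\nabla w|^{p-2}\nabla w, \] where $DA$ is the Jacobian matrix of $A$. For symmetric matrices, $\geq0$ means positive semidefinite. "All such $U,w,x$" means: all open $U\subset\mathbb R^N$, all $w\in C^2(U)$ and all $x\in U$ with $\nabla w(x)\ne0$. *)

theory Defs
  imports "HOL-Analysis.Analysis"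
begin

text \<open>
  The operators below are total functions; their values are meaningful only at points
  where the functions involved are differentiable. Functions in \<open>C\<^sup>2(U)\<close> are
  represented by total functions, whose values outside the open set \<open>U\<close> are irrelevant.
\<close>

definition grad :: "(real^'n \<Rightarrow> real) \<Rightarrow> real^'n \<Rightarrow> real^'n" where
  "grad w x = (THE D. GDERIV w x :> D)"

lemma grad_eqI:
  assumes "GDERIV w x :> D"
  shows "grad w x = D"
  unfolding grad_def
proof (rule the_equality)
  show "GDERIV w x :> D" by fact
next
  fix D' assume "GDERIV w x :> D'"
  then have "(\<lambda>h. h \<bullet> D') = (\<lambda>h. h \<bullet> D)"
    using assms unfolding gderiv_def by (rule has_derivative_unique)
  then show "D' = D"
    by (metis vector_eq_ldot)
qed

lemma GDERIV_grad:
  assumes "w differentiable (at x)"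
  shows "GDERIV w x :> grad w x"
proof -
  obtain w' where w': "(w has_derivative w') (at x)"
    using assms by (auto simp: differentiable_def)
  have "h \<bullet> adjoint w' 1 = w' h" for h
    using adjoint_works[OF has_derivative_linear[OF w'], of h 1] by simp
  with w' have "GDERIV w x :> adjoint w' 1"
    by (simp add: gderiv_def)
  then show ?thesis
    using grad_eqI by metis
qed

definition hess :: "(real^'n \<Rightarrow> real) \<Rightarrow> real^'n \<Rightarrow> real^'n^'n" where
  "hess w x = jacobian (grad w) (at x)"

text \<open>Intended for open \<open>U\<close> only.\<close>
definition C2_on :: "(real^'n) set \<Rightarrow> (real^'n \<Rightarrow> real) \<Rightarrow> bool" where
  "C2_on U w \<longleftrightarrow>
     (\<forall>x\<in>U. w differentiable (at x)) \<and>
     (\<forall>x\<in>U. grad w differentiable (at x)) \<and>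
     continuous_on U (hess w)"

definition psd :: "real^'n^'n \<Rightarrow> bool" where
  "psd M \<longleftrightarrow> transpose M = M \<and> (\<forall>v. 0 \<le> v \<bullet> (M *v v))"

definition pflux :: "real \<Rightarrow> (real^'n \<Rightarrow> real) \<Rightarrow> real^'n \<Rightarrow> real^'n" where
  "pflux p w y = norm (grad w y) powr (p - 2) *\<^sub>R grad w y"

text \<open>The matrix \<open>M\<^sub>p[w](x)\<close>; meaningful where \<open>grad w x \<noteq> 0\<close>.\<close>
definition Mp :: "real \<Rightarrow> (real^'n \<Rightarrow> real) \<Rightarrow> real^'n \<Rightarrow> real^'n^'n" where
  "Mp p w x =
     (1 / 2) *\<^sub>R (jacobian (pflux p w) (at x) + transpose (jacobian (pflux p w) (at x)))"

end

theory Submission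
  imports Defs
begin

text \<open>
  Put \<open>g = \<nabla>w(x)\<close>, \<open>n = g/|g|\<close> and \<open>H = D\<^sup>2w(x)\<close>. Up to the positive factor \<open>|g|\<close> to the power
  \<open>p - 2\<close>, the quadratic form of \<open>M\<^sub>p\<close> at \<open>v\<close> is \<open>v \<bullet> Hv + (p - 2) (n \<bullet> v) (n \<bullet> Hv)\<close>.
  For \<open>v = s n + u\<close> with \<open>u\<close> orthogonal to \<open>n\<close> it equals
  \<open>(p - 1) s\<^sup>2 (n \<bullet> Hn) + p s (n \<bullet> Hu) + u \<bullet> Hu\<close>. Replacing \<open>s\<close> by \<open>2s/p\<close> turns the mixed term into
  that of \<open>v \<bullet> Hv\<close>, while the coefficient of \<open>s\<^sup>2 (n \<bullet> Hn)\<close> becomes \<open>4 (p - 1)/p\<^sup>2 \<le> 1\<close>; since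
  \<open>n \<bullet> Hn \<ge> 0\<close>, nonnegativity of the first form forces that of the second.
  The inequality \<open>4 (p - 1) \<le> p\<^sup>2\<close> is strict unless \<open>p = 2\<close>, so a rank-one Hessian \<open>h h\<^sup>T\<close> with \<open>h\<close>
  neither parallel nor orthogonal to \<open>g\<close> violates the converse.
\<close>

section \<open>Symmetry of the Hessian\<close>

text \<open>Group the four values as an increment in direction \<open>t v\<close> of
  \<open>w\<close>, viewed as a function of the position along \<open>u\<close>. The mean value
  theorem in that position turns it into \<open>t\<close> times an increment of
  \<open>u \<bullet> grad w\<close>, and differentiability of \<open>grad w\<close> at the single
  point \<open>x\<close> linearises this increment up to an error of order
  \<open>e t\<close>.\<close>

lemma second_difference_bound:
  fixes w :: "real^'n \<Rightarrow> real"
  assumes U: "open U" "x \<in> U" and w: "\<And>y. y \<in> U \<Longrightarrow> w differentiable (at y)"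
    and H: "(grad w has_derivative (\<lambda>h. H *v h)) (at x)" and e: "e > 0"
  shows "\<exists>d>0. \<forall>t. 0 < t \<longrightarrow> t < d \<longrightarrow>
    \<bar>w (x + t *\<^sub>R v + t *\<^sub>R u) - w (x + t *\<^sub>R u) - w (x + t *\<^sub>R v) + w x - t\<^sup>2 * (u \<bullet> (H *v v))\<bar>
      \<le> e * t\<^sup>2"
proof -
  \<comment> \<open>The remainders at the two compared points add up to at most
    \<open>c t (K - 1)\<close>. The extra 1 keeps \<open>K\<close> positive when
    \<open>u = 0\<close>, so that \<open>c = e / K\<close> makes sense.\<close>
  define K where "K = (2 * norm u + norm v) * norm u + 1"
  have K: "K > 0" by (simp add: K_def add_nonneg_pos)
  define c where "c = e / K"
  have c: "c > 0" "c * K = e" using e K by (auto simp: c_def)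
  obtain r where r: "r > 0" "ball x r \<subseteq> U"
    using U openE by blast
  have "\<forall>e>0. \<exists>d>0. \<forall>y. norm (y - x) < d \<longrightarrow>
      norm (grad w y - grad w x - H *v (y - x)) \<le> e * norm (y - x)"
    using H by (simp add: has_derivative_at_alt)
  then obtain d0 where d0: "d0 > 0" and D: "\<And>y. norm (y - x) < d0 \<Longrightarrow>
      norm (grad w y - grad w x - H *v (y - x)) \<le> c * norm (y - x)"
    using c by metis
  \<comment> \<open>For \<open>t < d\<close> the whole parallelogram of points
    \<open>x + a v + s u\<close> with \<open>a\<close>, \<open>s\<close> in \<open>[0, t]\<close>
    then lies both in the ball inside \<open>U\<close> and in the region where the linearisation
    estimate holds.\<close>
  define S where "S = norm u + norm v + 1"
  have S: "S > 0" by (simp add: S_def add_nonneg_pos)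
  define d where "d = min r d0 / S"
  have d: "d > 0" using r d0 S by (simp add: d_def)
  have main: "\<bar>w (x + t *\<^sub>R v + t *\<^sub>R u) - w (x + t *\<^sub>R u) - w (x + t *\<^sub>R v) + w x - t\<^sup>2 * (u \<bullet> (H *v v))\<bar>
      \<le> e * t\<^sup>2" if t: "0 < t" "t < d" for t
  proof -
    have tS: "t * S < min r d0" using t S by (simp add: d_def field_simps)
    have small: "norm (a *\<^sub>R v + s *\<^sub>R u) < min r d0" if "0 \<le> s" "s \<le> t" "0 \<le> a" "a \<le> t" for s a
    proof -
      have "norm (a *\<^sub>R v + s *\<^sub>R u) \<le> a * norm v + s * norm u"
        using that norm_triangle_ineq[of "a *\<^sub>R v" "s *\<^sub>R u"] by simp
      also have "\<dots> \<le> t * norm v + t * norm u"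
        using that by (intro add_mono mult_right_mono) auto
      also have "\<dots> \<le> t * S" using t by (simp add: S_def algebra_simps)
      finally show ?thesis using tS by simp
    qed
    have inU: "x + a *\<^sub>R v + s *\<^sub>R u \<in> U" if "0 \<le> s" "s \<le> t" "0 \<le> a" "a \<le> t" for s a
      using small[OF that] r(2) by (force simp: dist_norm norm_minus_commute algebra_simps)
    \<comment> \<open>The vanishing summand \<open>0 *\<^sub>R v\<close> lets \<open>der\<close>
      serve both terms, with \<open>a = t\<close> and \<open>a = 0\<close>.\<close>
    define f where "f s = w (x + t *\<^sub>R v + s *\<^sub>R u) - w (x + 0 *\<^sub>R v + s *\<^sub>R u)" for s
    define f' where "f' s = u \<bullet> (grad w (x + t *\<^sub>R v + s *\<^sub>R u) - grad w (x + 0 *\<^sub>R v + s *\<^sub>R u))" for s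
    have der: "((\<lambda>s. w (x + a *\<^sub>R v + s *\<^sub>R u)) has_real_derivative
        u \<bullet> grad w (x + a *\<^sub>R v + s *\<^sub>R u)) (at s)"
      if "0 \<le> s" "s \<le> t" "0 \<le> a" "a \<le> t" for s a
    proof -
      have "(w has_derivative (\<lambda>h. h \<bullet> grad w (x + a *\<^sub>R v + s *\<^sub>R u))) (at (x + a *\<^sub>R v + s *\<^sub>R u))"
        using GDERIV_grad[OF w[OF inU[OF that]]] by (simp add: gderiv_def)
      moreover have "((\<lambda>s. x + a *\<^sub>R v + s *\<^sub>R u) has_derivative (\<lambda>h. h *\<^sub>R u)) (at s)"
        by (auto intro!: derivative_eq_intros)
      ultimately have "((\<lambda>s. w (x + a *\<^sub>R v + s *\<^sub>R u)) has_derivative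
          (\<lambda>h. (h *\<^sub>R u) \<bullet> grad w (x + a *\<^sub>R v + s *\<^sub>R u))) (at s)"
        by (rule has_derivative_compose[rotated])
      then show ?thesis
        by (simp add: has_field_derivative_def mult_commute_abs)
    qed
    have "(f has_real_derivative f' s) (at s)" if "0 \<le> s" "s \<le> t" for s
      unfolding f_def f'_def inner_diff_right using that t by (intro DERIV_diff der) auto
    then obtain z where z: "0 < z" "z < t" "f t - f 0 = (t - 0) * f' z"
      using MVT2[OF t(1), of f f'] by auto
    \<comment> \<open>The linear parts at the two points differ by exactly \<open>t (H v)\<close>,
      so only the Taylor remainders \<open>R\<close> survive in \<open>f'z\<close>.\<close>
    define R where "R y = grad w y - grad w x - H *v (y - x)" for y
    have f'z: "f' z - t * (u \<bullet> (H *v v)) = u \<bullet> (R (x + t *\<^sub>R v + z *\<^sub>R u) - R (x + z *\<^sub>R u))"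
      by (simp add: f'_def R_def algebra_simps)
    have R1: "norm (R (x + t *\<^sub>R v + z *\<^sub>R u)) \<le> c * (t * (norm v + norm u))"
    proof -
      have "norm (R (x + t *\<^sub>R v + z *\<^sub>R u)) \<le> c * norm (t *\<^sub>R v + z *\<^sub>R u)"
        using D[of "x + t *\<^sub>R v + z *\<^sub>R u"] small[of z t] z t by (simp add: R_def add.assoc)
      also have "norm (t *\<^sub>R v + z *\<^sub>R u) \<le> t * norm v + z * norm u"
        using z t norm_triangle_ineq[of "t *\<^sub>R v" "z *\<^sub>R u"] by simp
      also have "\<dots> \<le> t * (norm v + norm u)"
        using z t by (simp add: distrib_left mult_right_mono)
      finally show ?thesis using c by (simp add: mult_left_mono)
    qed
    have R2: "norm (R (x + z *\<^sub>R u)) \<le> c * (t * norm u)"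
    proof -
      have "norm (R (x + z *\<^sub>R u)) \<le> c * norm (z *\<^sub>R u)"
        using D[of "x + z *\<^sub>R u"] small[of z 0] z t by (simp add: R_def)
      also have "norm (z *\<^sub>R u) \<le> t * norm u"
        using z t by (simp add: mult_right_mono)
      finally show ?thesis using c by (simp add: mult_left_mono)
    qed
    have "\<bar>f' z - t * (u \<bullet> (H *v v))\<bar> \<le> norm u * norm (R (x + t *\<^sub>R v + z *\<^sub>R u) - R (x + z *\<^sub>R u))"
      unfolding f'z by (rule Cauchy_Schwarz_ineq2)
    also have "\<dots> \<le> norm u * (c * (t * (norm v + norm u)) + c * (t * norm u))"
      using norm_triangle_ineq4[of "R (x + t *\<^sub>R v + z *\<^sub>R u)" "R (x + z *\<^sub>R u)"] R1 R2
      by (intro mult_left_mono) auto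
    also have "\<dots> = c * t * (K - 1)" by (simp add: K_def algebra_simps)
    also have "\<dots> \<le> c * t * K" using c t by (intro mult_left_mono) auto
    also have "\<dots> = e * t" using c(2) by (simp add: mult_ac)
    finally have b: "\<bar>f' z - t * (u \<bullet> (H *v v))\<bar> \<le> e * t" .
    have "w (x + t *\<^sub>R v + t *\<^sub>R u) - w (x + t *\<^sub>R u) - w (x + t *\<^sub>R v) + w x - t\<^sup>2 * (u \<bullet> (H *v v))
        = (f t - f 0) - t\<^sup>2 * (u \<bullet> (H *v v))"
      by (simp add: f_def)
    also have "\<dots> = t * (f' z - t * (u \<bullet> (H *v v)))"
      unfolding z(3) by (simp add: algebra_simps power2_eq_square)
    also have "\<bar>\<dots>\<bar> \<le> t * (e * t)" using b t by (simp add: abs_mult)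
    finally show ?thesis by (simp add: power2_eq_square mult_ac)
  qed
  with d show ?thesis by blast
qed

text \<open>The second difference is invariant under exchanging \<open>u\<close> and
  \<open>v\<close>. Its two approximations, \<open>t\<^sup>2 (u \<bullet> Hv)\<close> and
  \<open>t\<^sup>2 (v \<bullet> Hu)\<close>, therefore differ by at most \<open>e t\<^sup>2\<close>
  for small \<open>t\<close>; divide by \<open>t\<^sup>2\<close> and let \<open>e\<close> tend to
  0.\<close>

theorem hess_symmetric:
  fixes w :: "real^'n \<Rightarrow> real"
  assumes U: "open U" "x \<in> U" and w: "\<And>y. y \<in> U \<Longrightarrow> w differentiable (at y)"
    and H: "grad w differentiable (at x)"
  shows "transpose (hess w x) = hess w x"
proof -
  define H where "H = hess w x"
  have dH: "(grad w has_derivative (\<lambda>h. H *v h)) (at x)"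
    using H jacobian_works unfolding H_def hess_def by blast
  have sym: "u \<bullet> (H *v v) = v \<bullet> (H *v u)" for u v
  proof -
    have "\<bar>u \<bullet> (H *v v) - v \<bullet> (H *v u)\<bar> \<le> 0 + e" if e: "e > 0" for e
    proof -
      have e2: "e/2 > 0" using e by simp
      obtain d1 where d1: "d1 > 0" and b1: "\<And>t. 0 < t \<Longrightarrow> t < d1 \<Longrightarrow> \<bar>w (x + t *\<^sub>R v + t *\<^sub>R u) - w (x + t *\<^sub>R u) - w (x + t *\<^sub>R v) + w x - t\<^sup>2 * (u \<bullet> (H *v v))\<bar>
          \<le> e/2 * t\<^sup>2"
        using second_difference_bound[OF U w dH e2, of v u] by blast
      obtain d2 where d2: "d2 > 0" and b2: "\<And>t. 0 < t \<Longrightarrow> t < d2 \<Longrightarrow> \<bar>w (x + t *\<^sub>R u + t *\<^sub>R v) - w (x + t *\<^sub>R v) - w (x + t *\<^sub>R u) + w x - t\<^sup>2 * (v \<bullet> (H *v u))\<bar>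
          \<le> e/2 * t\<^sup>2"
        using second_difference_bound[OF U w dH e2, of u v] by blast
      define t where "t = min d1 d2 / 2"
      have t: "0 < t" "t < d1" "t < d2" using d1 d2 by (auto simp: t_def)
      have sw: "x + t *\<^sub>R u + t *\<^sub>R v = x + t *\<^sub>R v + t *\<^sub>R u" by simp
      have "\<bar>t\<^sup>2 * (u \<bullet> (H *v v)) - t\<^sup>2 * (v \<bullet> (H *v u))\<bar> \<le> e/2 * t\<^sup>2 + e/2 * t\<^sup>2"
        using b1[OF t(1,2)] b2[OF t(1,3)] unfolding sw by linarith
      then have "t\<^sup>2 * \<bar>u \<bullet> (H *v v) - v \<bullet> (H *v u)\<bar> \<le> t\<^sup>2 * e"
        by (simp add: abs_mult mult.commute[of _ e] flip: right_diff_distrib)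
      then show ?thesis using t by simp
    qed
    then have "\<bar>u \<bullet> (H *v v) - v \<bullet> (H *v u)\<bar> \<le> 0" by (rule field_le_epsilon)
    then show ?thesis by simp
  qed
  have "H $ i $ j = H $ j $ i" for i j
    using sym[of "axis i 1" "axis j 1"]
    by (simp add: matrix_vector_mult_basis column_def inner_axis')
  then show ?thesis by (simp add: H_def[symmetric] transpose_def vec_eq_iff)
qed

section \<open>The quadratic form of \<open>Mp\<close>\<close>

text \<open>Product rule for the scalar power and the gradient. A nonzero gradient makes the norm
  differentiable there, with derivative the inner product with \<open>sgn (grad w x)\<close>, and
  gives the power a positive base.\<close>

lemma has_derivative_pflux:
  fixes w :: "real^'n \<Rightarrow> real"
  assumes H: "grad w differentiable (at x)" and nz: "grad w x \<noteq> 0"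
  shows "(pflux p w has_derivative
    (\<lambda>h. norm (grad w x) powr (p - 2) *\<^sub>R (hess w x *v h +
       ((p - 2) * (grad w x \<bullet> (hess w x *v h)) / (norm (grad w x))\<^sup>2) *\<^sub>R grad w x))) (at x)"
proof -
  have dH: "(grad w has_derivative (\<lambda>h. hess w x *v h)) (at x)"
    using H jacobian_works unfolding hess_def by blast
  have n: "((\<lambda>y. norm (grad w y)) has_derivative (\<lambda>h. (hess w x *v h) \<bullet> sgn (grad w x))) (at x)"
    using has_derivative_compose[OF dH has_derivative_norm[OF nz]] .
  have pos: "norm (grad w x) > 0" using nz by simp
  show ?thesis
    unfolding pflux_def
    by (rule has_derivative_eq_rhs[OF has_derivative_scaleR[OF
            has_derivative_powr[OF n has_derivative_const pos UNIV_I] dH]])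
      (simp add: fun_eq_iff sgn_div_norm inner_commute scaleR_add_right power2_eq_square field_simps)
qed

text \<open>A matrix and its transpose have the same quadratic form, so symmetrising the Jacobian of
  the flux does not change the form, which is then read off from
  \<open>has_derivative_pflux\<close>.\<close>

lemma inner_Mp:
  fixes w :: "real^'n \<Rightarrow> real"
  assumes H: "grad w differentiable (at x)" and nz: "grad w x \<noteq> 0"
  shows "v \<bullet> (Mp p w x *v v) = norm (grad w x) powr (p - 2) *
    (v \<bullet> (hess w x *v v) + (p - 2) * (grad w x \<bullet> v) * (grad w x \<bullet> (hess w x *v v)) / (norm (grad w x))\<^sup>2)"
proof -
  define J where "J = jacobian (pflux p w) (at x)"
  have "(pflux p w has_derivative (\<lambda>h. J *v h)) (at x)"
    using has_derivative_pflux[OF assms] jacobian_works unfolding J_def differentiable_def by blast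
  then have J: "J *v v = norm (grad w x) powr (p - 2) *\<^sub>R (hess w x *v v +
       ((p - 2) * (grad w x \<bullet> (hess w x *v v)) / (norm (grad w x))\<^sup>2) *\<^sub>R grad w x)"
    by (rule fun_cong[OF has_derivative_unique[OF _ has_derivative_pflux[OF assms]]])
  have "v \<bullet> (transpose J *v v) = v \<bullet> (J *v v)"
    by (metis dot_lmul_matrix inner_commute vector_transpose_matrix transpose_transpose)
  then have "v \<bullet> (Mp p w x *v v) = v \<bullet> (J *v v)"
    by (simp add: Mp_def J_def[symmetric] scaleR_matrix_vector_assoc[symmetric]
        matrix_vector_mult_add_rdistrib inner_add_right)
  then show ?thesis
    by (simp add: J inner_add_right inner_commute)
qed

lemma transpose_Mp: "transpose (Mp p w x) = Mp p w x"
  by (simp add: Mp_def transpose_def vec_eq_iff add.commute)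

section \<open>From \<open>Mp\<close> to the Hessian\<close>

lemma psd_hess_if_psd_Mp:
  fixes w :: "real^'n \<Rightarrow> real"
  assumes p: "p > 1" and sym: "transpose (hess w x) = hess w x"
    and H: "grad w differentiable (at x)" and nz: "grad w x \<noteq> 0" and M: "psd (Mp p w x)"
  shows "psd (hess w x)"
proof -
  define g where "g = grad w x"
  define H where "H = hess w x"
  define N where "N = (norm g)\<^sup>2"
  have N: "N > 0" "g \<bullet> g = N" using nz by (auto simp: N_def g_def power2_norm_eq_inner)
  have sH: "u \<bullet> (H *v v) = v \<bullet> (H *v u)" for u v
    using sym unfolding H_def by (metis dot_lmul_matrix inner_commute vector_transpose_matrix)
  have Q: "0 \<le> v \<bullet> (H *v v) + (p - 2) * (g \<bullet> v) * (g \<bullet> (H *v v)) / N" for v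
  proof -
    have "0 \<le> norm g powr (p - 2) * (v \<bullet> (H *v v) + (p - 2) * (g \<bullet> v) * (g \<bullet> (H *v v)) / N)"
      using M inner_Mp[OF H nz, of v p] unfolding psd_def g_def H_def N_def by metis
    then show ?thesis
      using nz by (simp add: zero_le_mult_iff g_def)
  qed
  \<comment> \<open>Along \<open>g\<close> itself the correction term is a multiple of the main
    term, leaving the factor \<open>p - 1\<close>, positive by assumption.\<close>
  have a: "0 \<le> g \<bullet> (H *v g)"
  proof -
    have "0 \<le> g \<bullet> (H *v g) + (p - 2) * (g \<bullet> (H *v g))" using Q[of g] N by simp
    also have "\<dots> = (p - 1) * (g \<bullet> (H *v g))" by (simp add: algebra_simps)
    finally show ?thesis using p by (simp add: zero_le_mult_iff)
  qed
  have "0 \<le> v \<bullet> (H *v v)" for v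
  proof -
    \<comment> \<open>The vector \<open>g\<close> is not normalised here: \<open>s\<close> is the
      coefficient of \<open>v\<close> along \<open>g\<close>, and the factor \<open>N\<close> in
      \<open>g \<bullet> v = s N\<close> cancels the denominator in \<open>Q\<close>.\<close>
    define s where "s = (g \<bullet> v) / N"
    define u where "u = v - s *\<^sub>R g"
    define t where "t = 2 * s / p"
    have v: "v = s *\<^sub>R g + u" by (simp add: u_def)
    have gu: "g \<bullet> u = 0" using N by (simp add: u_def inner_diff_right s_def)
    have b: "u \<bullet> (H *v g) = g \<bullet> (H *v u)" by (rule sH)
    have "0 \<le> (t *\<^sub>R g + u) \<bullet> (H *v (t *\<^sub>R g + u))
        + (p - 2) * (g \<bullet> (t *\<^sub>R g + u)) * (g \<bullet> (H *v (t *\<^sub>R g + u))) / N"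
      by (rule Q)
    also have "\<dots> = (p - 1) * t\<^sup>2 * (g \<bullet> (H *v g)) + p * t * (g \<bullet> (H *v u)) + u \<bullet> (H *v u)"
    proof -
      have g: "g \<bullet> (t *\<^sub>R g + u) = t * N"
        by (simp add: inner_add_right gu N)
      have cancel: "(p - 2) * (g \<bullet> (t *\<^sub>R g + u)) * y / N = (p - 2) * t * y" for y
        unfolding g using N by simp
      show ?thesis
        unfolding cancel
        by (simp add: b algebra_simps power2_eq_square)
    qed
    also have "p * t = 2 * s" using p by (simp add: t_def)
    also have "(p - 1) * t\<^sup>2 * (g \<bullet> (H *v g)) \<le> s\<^sup>2 * (g \<bullet> (H *v g))"
    proof (rule mult_right_mono[OF _ a])
      have "p\<^sup>2 - 4 * (p - 1) = (p - 2)\<^sup>2" by (simp add: power2_eq_square algebra_simps)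
      then have "4 * (p - 1) \<le> p\<^sup>2" by (smt (verit) zero_le_power2)
      then have "s\<^sup>2 * (4 * (p - 1)) \<le> s\<^sup>2 * p\<^sup>2" by (rule mult_left_mono) simp
      then show "(p - 1) * t\<^sup>2 \<le> s\<^sup>2"
        using p by (simp add: t_def power_divide power_mult_distrib field_simps)
    qed
    also have "s\<^sup>2 * (g \<bullet> (H *v g)) + 2 * s * (g \<bullet> (H *v u)) + u \<bullet> (H *v u) = v \<bullet> (H *v v)"
      by (simp add: v b algebra_simps power2_eq_square)
    finally show ?thesis by simp
  qed
  then show ?thesis using sym by (simp add: psd_def H_def)
qed

section \<open>The converse: \<open>p = 2\<close> and counterexamples\<close>

text \<open>At \<open>p = 2\<close> the correction term vanishes and the power of the nonzero norm
  is 1, so both quadratic forms coincide.\<close>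

lemma psd_Mp_2_if_psd_hess:
  fixes w :: "real^'n \<Rightarrow> real"
  assumes H: "grad w differentiable (at x)" and nz: "grad w x \<noteq> 0" and "psd (hess w x)"
  shows "psd (Mp 2 w x)"
  using assms(3) by (simp add: psd_def transpose_Mp inner_Mp[OF H nz] nz)

text \<open>This family prescribes the gradient \<open>g\<close> at the origin and the constant
  rank-one Hessian formed from \<open>h\<close> independently of each other.\<close>

lemma grad_linear_plus_square:
  fixes g h :: "real^'n"
  shows "grad (\<lambda>y. g \<bullet> y + (h \<bullet> y)\<^sup>2 / 2) = (\<lambda>y. g + (h \<bullet> y) *\<^sub>R h)"
    and "(\<lambda>y. g \<bullet> y + (h \<bullet> y)\<^sup>2 / 2) differentiable (at x)"
proof -
  have *: "((\<lambda>y. g \<bullet> y + (h \<bullet> y)\<^sup>2 / 2) has_derivative (\<lambda>k. k \<bullet> (g + (h \<bullet> x) *\<^sub>R h))) (at x)" for x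
    by (auto intro!: derivative_eq_intros simp: inner_commute algebra_simps)
  show "grad (\<lambda>y. g \<bullet> y + (h \<bullet> y)\<^sup>2 / 2) = (\<lambda>y. g + (h \<bullet> y) *\<^sub>R h)"
    by (rule ext, rule grad_eqI) (simp add: gderiv_def *)
  show "(\<lambda>y. g \<bullet> y + (h \<bullet> y)\<^sup>2 / 2) differentiable (at x)"
    using * differentiable_def by blast
qed

lemma hess_linear_plus_square:
  fixes g h :: "real^'n"
  shows "hess (\<lambda>y. g \<bullet> y + (h \<bullet> y)\<^sup>2 / 2) = (\<lambda>x. \<chi> i j. h $ i * h $ j)"
    and "grad (\<lambda>y. g \<bullet> y + (h \<bullet> y)\<^sup>2 / 2) differentiable (at x)"
proof -
  have *: "((\<lambda>y. g + (h \<bullet> y) *\<^sub>R h) has_derivative (\<lambda>k. (h \<bullet> k) *\<^sub>R h)) (at x)" for x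
    by (auto intro!: derivative_eq_intros)
  have "jacobian (\<lambda>y. g + (h \<bullet> y) *\<^sub>R h) (at x) = (\<chi> i j. h $ i * h $ j)" for x
    unfolding jacobian_def frechet_derivative_at[OF *, symmetric]
    by (simp add: matrix_def inner_axis mult.commute)
  then show "hess (\<lambda>y. g \<bullet> y + (h \<bullet> y)\<^sup>2 / 2) = (\<lambda>x. \<chi> i j. h $ i * h $ j)"
    by (simp add: fun_eq_iff hess_def grad_linear_plus_square)
  show "grad (\<lambda>y. g \<bullet> y + (h \<bullet> y)\<^sup>2 / 2) differentiable (at x)"
    unfolding grad_linear_plus_square using * differentiable_def by blast
qed

lemma psd_hess_not_psd_Mp:
  fixes p :: real
  assumes "CARD('n::finite) \<ge> 2" and p: "p \<noteq> 2"
  shows "\<exists>w :: real^'n \<Rightarrow> real. C2_on UNIV w \<and> grad w 0 \<noteq> 0 \<and> psd (hess w 0) \<and> \<not> psd (Mp p w 0)"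
proof -
  obtain i j :: 'n where ij: "i \<noteq> j"
    using assms(1) by (metis (full_types) card_2_iff' ex_card)
  \<comment> \<open>With this \<open>g\<close> and \<open>h\<close>, the form of \<open>Mp\<close>
    at \<open>axis i 1 + b *\<^sub>R axis j 1\<close> is \<open>(1 + b) (p - 1 + b)\<close>. Its
    roots \<open>-1\<close> and \<open>1 - p\<close> are distinct for \<open>p \<noteq> 2\<close>;
    \<open>v\<close> takes their midpoint \<open>b = - p / 2\<close>, where the minimum
    \<open>- (1 - p / 2)\<^sup>2\<close> is attained.\<close>
  define g h v :: "real^'n" where "g = axis i 1" and "h = axis i 1 + axis j 1"
    and "v = axis i 1 - (p / 2) *\<^sub>R axis j 1"
  define w where "w = (\<lambda>y. g \<bullet> y + (h \<bullet> y)\<^sup>2 / 2)"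
  note gr = grad_linear_plus_square[of g h, folded w_def]
  note hs = hess_linear_plus_square[of g h, folded w_def]
  have Hv: "hess w x *v y = (h \<bullet> y) *\<^sub>R h" for x y
    unfolding hs
    by (simp add: vec_eq_iff matrix_vector_mult_def inner_vec_def sum_distrib_left sum_distrib_right mult_ac)
  have g0: "grad w 0 = g" by (simp add: gr)
  have nz: "grad w 0 \<noteq> 0" by (simp add: g0 g_def)
  have "C2_on UNIV w"
    using gr(2) hs(2) by (simp add: C2_on_def hs(1))
  moreover have "psd (hess w 0)"
    unfolding psd_def Hv by (simp add: hs transpose_def mult.commute inner_commute)
  moreover have "\<not> psd (Mp p w 0)"
  proof
    assume "psd (Mp p w 0)"
    then have "0 \<le> v \<bullet> (Mp p w 0 *v v)" by (simp add: psd_def)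
    moreover have "h \<bullet> v = 1 - p / 2" "g \<bullet> v = 1" "g \<bullet> h = 1" "norm g = 1"
      using ij by (simp_all add: h_def v_def g_def inner_add_left inner_add_right inner_diff_right inner_axis_axis)
    ultimately have "0 \<le> (1 - p/2) * (1 - p/2) + (p - 2) * (1 - p/2)"
      unfolding inner_Mp[OF hs(2) nz] Hv g0 by (simp add: inner_commute)
    also have "\<dots> = - (1 - p/2)\<^sup>2" by (simp add: power2_eq_square field_simps)
    finally show False using p by simp
  qed
  ultimately show ?thesis using nz by blast
qed

theorem theorem1p9:
  fixes p :: real
  assumes "CARD('n::finite) \<ge> 2" and "p > 1"
  shows
    "(\<forall>(U :: (real^'n) set) w x.
        open U \<and> C2_on U w \<and> x \<in> U \<and> grad w x \<noteq> 0 \<longrightarrow>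
        psd (Mp p w x) \<longrightarrow> psd (hess w x))
     \<and>
     ((\<forall>(U :: (real^'n) set) w x.
        open U \<and> C2_on U w \<and> x \<in> U \<and> grad w x \<noteq> 0 \<longrightarrow>
        psd (hess w x) \<longrightarrow> psd (Mp p w x))
      \<longleftrightarrow> p = 2)"
proof (intro conjI iffI allI impI)
  fix U :: "(real^'n) set" and w x
  assume *: "open U \<and> C2_on U w \<and> x \<in> U \<and> grad w x \<noteq> 0" and M: "psd (Mp p w x)"
  have "transpose (hess w x) = hess w x"
    using * by (intro hess_symmetric[of U]) (auto simp: C2_on_def)
  with * M show "psd (hess w x)"
    by (intro psd_hess_if_psd_Mp[OF \<open>p > 1\<close>]) (auto simp: C2_on_def)
next
  assume *: "\<forall>(U :: (real^'n) set) w x.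
        open U \<and> C2_on U w \<and> x \<in> U \<and> grad w x \<noteq> 0 \<longrightarrow>
        psd (hess w x) \<longrightarrow> psd (Mp p w x)"
  show "p = 2"
    using psd_hess_not_psd_Mp[OF assms(1), of p] * by blast
next
  fix U :: "(real^'n) set" and w x
  assume "p = 2" "open U \<and> C2_on U w \<and> x \<in> U \<and> grad w x \<noteq> 0" "psd (hess w x)"
  then show "psd (Mp p w x)"
    by (auto simp: C2_on_def intro: psd_Mp_2_if_psd_hess)
qed

end
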